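(* For any uniform determinantal representation $M=M_0+M_1$ of size $N$ of $p_{n,d}$, the determinant of $M_0$ is the zero polynomial in $K[x_1,\ldots,x_n]$. Moreover, at every point $\bar{x}\in K^n$, the rank of the specialisation $M_0(\bar{x})\in K^{N\times N}$ is exactly $N-1$.
   Context: Let $K$ be a field and $n,d\in\mathbb{Z}_{\ge 0}$. The generic polynomial of degree $d$ in $n$ variables is $p_{n,d}=\sum_{|\alpha|\le d} c_\alpha x^\alpha$, where $x=(x_1,\ldots,x_n)$, $\alpha\in\mathbb{Z}_{\ge 0}^n$, $|\alpha|=\sum_i\alpha_i$, and each $c_\alpha$ is regarded as a variable. A uniform determinantal representation of $p_{n,d}$ of size $N$ is an $N\times N$ matrix $M$ whose entries are $K$-linear combinations of the monomials $1,x_i,c_\alpha,c_\alpha x_i$ ($1\le i\le n$, $|\alpha|\le d$), such that $\det(M)=p_{n,d}$. One writes $M=M_0+M_1$, where $M_0$ contains all terms of $M$ not containing any $c_\alpha$ and $M_1$ contains all terms that do. *)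

theory Defs
  imports
    "HOL-Library.Poly_Mapping"
    "Jordan_Normal_Form.Determinant"
    "Jordan_Normal_Form.DL_Rank"
begin

text \<open>
  Polynomials over a field in the variables \<open>x\<^sub>i\<close> and \<open>c\<^sub>\<alpha>\<close> are formal polynomials (not polynomial
  functions, since the field may be finite): finitely supported maps from monomials to
  coefficients. The variables \<open>x\<^sub>1, \<dots>, x\<^sub>n\<close> are \<open>X i\<close> with \<open>i < n\<close>. An exponent
  \<open>\<alpha> \<in> \<nat>\<^sup>n\<close> is a finitely supported function on \<open>nat\<close> that vanishes outside \<open>{..<n}\<close>.
\<close>

datatype pvar = X nat | C "nat \<Rightarrow>\<^sub>0 nat"

type_synonym monom = "pvar \<Rightarrow>\<^sub>0 nat"
type_synonym 'a mpoly = "monom \<Rightarrow>\<^sub>0 'a"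

definition Var :: "pvar \<Rightarrow> 'a::field mpoly" where
  "Var v = Poly_Mapping.single (Poly_Mapping.single v 1) 1"

definition scale :: "'a::field \<Rightarrow> 'a mpoly \<Rightarrow> 'a mpoly" where
  "scale k p = Poly_Mapping.single 0 k * p"

global_interpretation mpoly: vector_space "scale :: 'a::field \<Rightarrow> 'a mpoly \<Rightarrow> 'a mpoly"
  by unfold_locales
    (simp_all add: scale_def distrib_left distrib_right single_add mult_single mult.assoc[symmetric])

definition eval :: "(pvar \<Rightarrow> 'a) \<Rightarrow> 'a::field mpoly \<Rightarrow> 'a" where
  "eval \<rho> p = (\<Sum>m\<in>Poly_Mapping.keys p. Poly_Mapping.lookup p m *
      (\<Prod>v\<in>Poly_Mapping.keys m. \<rho> v ^ Poly_Mapping.lookup m v))"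

definition exponents :: "nat \<Rightarrow> nat \<Rightarrow> (nat \<Rightarrow>\<^sub>0 nat) set" where
  "exponents n d = {\<alpha>. Poly_Mapping.keys \<alpha> \<subseteq> {..<n} \<and> (\<Sum>i<n. Poly_Mapping.lookup \<alpha> i) \<le> d}"

text \<open>Finiteness makes the sum in \<open>generic_poly\<close> meaningful.\<close>

lemma finite_exponents: "finite (exponents n d)"
proof -
  let ?F = "{f :: nat \<Rightarrow> nat. \<forall>i. (i \<in> {..<n} \<longrightarrow> f i \<in> {..d}) \<and> (i \<notin> {..<n} \<longrightarrow> f i = 0)}"
  have "Poly_Mapping.lookup ` exponents n d \<subseteq> ?F"
  proof clarify
    fix \<alpha> i
    assume a: "\<alpha> \<in> exponents n d"
    have "Poly_Mapping.lookup \<alpha> i \<le> d" if "i < n"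
      using a member_le_sum[of i "{..<n}" "Poly_Mapping.lookup \<alpha>"] that
      by (auto simp: exponents_def)
    moreover have "Poly_Mapping.lookup \<alpha> i = 0" if "\<not> i < n"
      using a that by (auto simp: exponents_def in_keys_iff subset_iff)
    ultimately show "(i \<in> {..<n} \<longrightarrow> Poly_Mapping.lookup \<alpha> i \<in> {..d}) \<and>
        (i \<notin> {..<n} \<longrightarrow> Poly_Mapping.lookup \<alpha> i = 0)"
      by simp
  qed
  then have "finite (Poly_Mapping.lookup ` exponents n d)"
    by (rule finite_subset) (rule finite_set_of_finite_funs; simp)
  then show ?thesis
    by (rule finite_imageD) (auto intro!: inj_onI poly_mapping_eqI)
qed

definition generic_poly :: "nat \<Rightarrow> nat \<Rightarrow> 'a::field mpoly" where
  "generic_poly n d =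
    (\<Sum>\<alpha>\<in>exponents n d. Var (C \<alpha>) * (\<Prod>i<n. Var (X i) ^ Poly_Mapping.lookup \<alpha> i))"

definition entry_monomials :: "nat \<Rightarrow> nat \<Rightarrow> 'a::field mpoly set" where
  "entry_monomials n d =
    {1} \<union> {Var (X i) | i. i < n} \<union> {Var (C \<alpha>) | \<alpha>. \<alpha> \<in> exponents n d}
      \<union> {Var (C \<alpha>) * Var (X i) | \<alpha> i. \<alpha> \<in> exponents n d \<and> i < n}"

definition uniform_det_rep :: "nat \<Rightarrow> nat \<Rightarrow> nat \<Rightarrow> 'a::field mpoly mat \<Rightarrow> bool" where
  "uniform_det_rep n d N M \<longleftrightarrow>
    M \<in> carrier_mat N N \<and>
    (\<forall>i<N. \<forall>j<N. M $$ (i, j) \<in> mpoly.span (entry_monomials n d)) \<and>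
    det M = generic_poly n d"

definition involves_C :: "monom \<Rightarrow> bool" where
  "involves_C m \<longleftrightarrow> (\<exists>\<alpha>. C \<alpha> \<in> Poly_Mapping.keys m)"

definition terms_with :: "(monom \<Rightarrow> bool) \<Rightarrow> 'a::field mpoly \<Rightarrow> 'a mpoly" where
  "terms_with P p =
    (\<Sum>m\<in>{m \<in> Poly_Mapping.keys p. P m}. Poly_Mapping.single m (Poly_Mapping.lookup p m))"

definition part0 :: "'a::field mpoly mat \<Rightarrow> 'a mpoly mat" where
  "part0 M = map_mat (terms_with (\<lambda>m. \<not> involves_C m)) M"

definition part1 :: "'a::field mpoly mat \<Rightarrow> 'a mpoly mat" where
  "part1 M = map_mat (terms_with involves_C) M"

lemma lookup_terms_with:
  "Poly_Mapping.lookup (terms_with P p) m = (if P m then Poly_Mapping.lookup p m else 0)"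
  by (auto simp: terms_with_def lookup_sum lookup_single when_def in_keys_iff sum.delta')

lemma part0_plus_part1: "part0 M + part1 M = M"
  by (rule eq_matI)
    (auto simp: part0_def part1_def lookup_add lookup_terms_with intro!: poly_mapping_eqI)

text \<open>
  The specialisation at a point of \<open>K\<^sup>n\<close> is applied only to \<open>part0 M\<close>, whose entries involve no
  variables besides \<open>X i\<close> with \<open>i < n\<close>, so the value 0 given to all other variables is irrelevant.
\<close>

definition specialise :: "nat \<Rightarrow> 'a vec \<Rightarrow> 'a::field mpoly mat \<Rightarrow> 'a mat" where
  "specialise n x A =
    map_mat (eval (\<lambda>v. case v of X i \<Rightarrow> if i < n then x $ i else 0 | C \<alpha> \<Rightarrow> 0)) A"

end

theory Submission
  imports Defs "Jordan_Normal_Form.DL_Rank_Submatrix"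
begin

text \<open>
  Write \<open>h\<close> for the ring endomorphism of the polynomial ring that substitutes 0 for every variable
  \<open>c\<^sub>\<alpha>\<close>. It sends the matrix \<open>M\<close> to \<open>M\<^sub>0\<close> and kills the generic polynomial, every term of which
  contains some \<open>c\<^sub>\<alpha>\<close>; so \<open>det M\<^sub>0 = h (det M) = 0\<close>.

  For the rank at a point \<open>x\<close>, substitute the coordinates of \<open>x\<close> for the variables \<open>x\<^sub>i\<close>, an
  indeterminate \<open>t\<close> for the constant coefficient \<open>c\<^sub>0\<close>, and 0 for all other \<open>c\<^sub>\<alpha>\<close>. The generic
  polynomial becomes \<open>t\<close>, so \<open>M\<close> becomes a matrix \<open>P\<close> over \<open>K[t]\<close> with \<open>det P = t\<close>, and setting
  \<open>t = 0\<close> in \<open>P\<close> gives \<open>M\<^sub>0(x)\<close>. Working over \<open>K[t]\<close> rather than with values of \<open>t\<close> in \<open>K\<close>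
  makes the argument independent of the size of \<open>K\<close>.

  It remains to see that a matrix \<open>P\<close> with \<open>det P = t\<close> has rank \<open>N - 1\<close> at \<open>t = 0\<close>
  (\<open>rank_at_simple_zero_of_det\<close>). Its determinant vanishes there, so the rank is at most \<open>N - 1\<close>.
  Were it smaller, all minors of size \<open>N - 1\<close> would vanish at \<open>t = 0\<close>, so \<open>t\<close> would divide the
  adjugate, say \<open>adj P = t R\<close>; taking determinants in \<open>P adj P = t I\<close> gives \<open>t\<^sup>N t det R = t\<^sup>N\<close>,
  and \<open>t\<close> would be a unit.
\<close>

section \<open>Rank and cofactors\<close>

text \<open>
  \<open>pick S k\<close> is the element of index \<open>k\<close>, counted from 0, in the increasing enumeration of \<open>S\<close>. For
  the complement of a point this is the index shift by which \<open>mat_delete\<close> skips a row or column;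
  the bound for minors in terms of the rank speaks of \<open>submatrix\<close>, whose indices come from \<open>pick\<close>.
\<close>

lemma pick_uminus_singleton: "pick (- {i}) k = (if k < i then k else Suc k)"
proof -
  define j where "j = (if k < i then k else Suc k)"
  have "{a \<in> - {i}. a < j} = (if k < i then {..<k} else {..<Suc k} - {i})"
    by (auto simp: j_def)
  then have "card {a \<in> - {i}. a < j} = k"
    by simp
  moreover have "pick (- {i}) (card {a \<in> - {i}. a < j}) = j"
    by (rule pick_card_in_set) (simp add: j_def)
  ultimately show ?thesis
    by (simp add: j_def)
qed

lemma card_less_uminus_singleton:
  fixes i n :: nat
  assumes "i < n"
  shows "card {a. a < n \<and> a \<in> - {i}} = n - 1"
proof -
  have "{a. a < n \<and> a \<in> - {i}} = {..<n} - {i}"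
    by auto
  with assms show ?thesis
    by simp
qed

lemma mat_delete_eq_submatrix:
  assumes "A \<in> carrier_mat n n" "i < n" "j < n"
  shows "mat_delete A i j = submatrix A (- {i}) (- {j})"
proof -
  have "dim_row A = n" "dim_col A = n"
    using assms by auto
  then show ?thesis
    unfolding mat_delete_def submatrix_def
    by (simp only: pick_uminus_singleton card_less_uminus_singleton[OF assms(2)]
        card_less_uminus_singleton[OF assms(3)])
qed

lemma (in vec_space) rank_ge_if_cofactor_nonzero:
  assumes A: "A \<in> carrier_mat n n" and i: "i < n" and j: "j < n"
    and nz: "cofactor A i j \<noteq> 0"
  shows "n - 1 \<le> rank A"
proof -
  have "det (submatrix A (- {i}) (- {j})) \<noteq> 0"
    using nz mat_delete_eq_submatrix[OF A i j] by (auto simp: cofactor_def)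
  then show ?thesis
    using rank_gt_minor[OF A] card_less_uminus_singleton[OF j] by fastforce
qed

lemma (in comm_ring_hom) hom_cofactor:
  assumes "A \<in> carrier_mat n n" "i < n" "j < n"
  shows "cofactor (map_mat hom A) i j = hom (cofactor A i j)"
proof -
  have "mat_delete (map_mat hom A) i j = map_mat hom (mat_delete A i j)"
    using assms by (intro eq_matI) (auto simp: mat_delete_def)
  then show ?thesis
    by (simp add: cofactor_def hom_distribs)
qed

lemma rank_at_simple_zero_of_det:
  fixes P :: "'a::field poly mat"
  assumes P: "P \<in> carrier_mat N N" and detP: "det P = [:0, 1:]"
  shows "vec_space.rank N (map_mat (\<lambda>p. poly p 0) P) + 1 = N"
proof -
  interpret ev: comm_ring_hom "\<lambda>p. poly p (0 :: 'a)"
    by unfold_locales auto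
  define A where "A = map_mat (\<lambda>p. poly p 0) P"
  have A: "A \<in> carrier_mat N N"
    using P by (simp add: A_def)
  have "N \<noteq> 0"
  proof
    assume "N = 0"
    then have "det P = 1"
      using P by simp
    with detP have "poly 1 0 = poly [:0, 1 :: 'a:] 0"
      by simp
    then show False
      by simp
  qed
  have "det A = 0"
    by (simp add: A_def detP)
  then have "vec_space.rank N A < N"
    using vec_space.det_rank_iff[OF A] vec_space.rank_le_nc[OF A] by fastforce
  moreover have "N - 1 \<le> vec_space.rank N A"
  proof (rule ccontr)
    assume low: "\<not> N - 1 \<le> vec_space.rank N A"
    \<comment> \<open>The cofactors of \<open>P\<close> reduce to those of \<open>A\<close>, which are, up to sign, minors of
      size \<open>N - 1\<close> and hence larger than the rank.\<close>
    have cof: "[:0, 1:] dvd cofactor P i j" if "i < N" "j < N" for i j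
    proof -
      have "cofactor A i j = 0"
        using vec_space.rank_ge_if_cofactor_nonzero[OF A that] low by blast
      then have "poly (cofactor P i j) 0 = 0"
        using ev.hom_cofactor[OF P that] by (simp add: A_def)
      then show ?thesis
        by (simp add: poly_eq_0_iff_dvd)
    qed
    define R where "R = map_mat (\<lambda>p. p div [:0, 1:]) (adj_mat P)"
    have R: "R \<in> carrier_mat N N"
      using adj_mat(1)[OF P] by (simp add: R_def)
    have "adj_mat P = [:0, 1:] \<cdot>\<^sub>m R"
      using P cof
      by (intro eq_matI) (auto simp: R_def adj_mat_def dvd_mult_div_cancel simp del: mult_pCons_left)
    then have "P * ([:0, 1:] \<cdot>\<^sub>m R) = [:0, 1:] \<cdot>\<^sub>m 1\<^sub>m N"
      using adj_mat(2)[OF P] detP by simp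
    then have "det (P * ([:0, 1:] \<cdot>\<^sub>m R)) = det ([:0, 1:] \<cdot>\<^sub>m 1\<^sub>m N)"
      by simp
    then have "[:0, 1:] * ([:0, 1:] ^ N * det R) = [:0, 1:] ^ N"
      using P R detP by (simp add: det_mult[of _ N])
    then have "[:0, 1:] ^ N * ([:0, 1:] * det R) = [:0, 1:] ^ N * 1"
      by (simp only: mult.left_commute mult_1_right)
    then have "[:0, 1:] * det R = 1"
      by (subst (asm) mult_left_cancel) auto
    then have "poly ([:0, 1:] * det R) 0 = poly 1 0"
      by (rule arg_cong)
    then show False
      by simp
  qed
  ultimately show ?thesis
    using \<open>N \<noteq> 0\<close> unfolding A_def[symmetric] by linarith
qed

section \<open>Ring homomorphisms on formal polynomials\<close>

lemma update_eq_add_single: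
  assumes "k \<notin> Poly_Mapping.keys p"
  shows "Poly_Mapping.update k a p = p + Poly_Mapping.single k a"
  using assms
  by (intro poly_mapping_eqI) (auto simp: lookup_update lookup_add lookup_single in_keys_iff when_def)

lemma mpoly_induct [case_names zero add]:
  assumes "Q 0" and "\<And>p m a. Q p \<Longrightarrow> Q (p + Poly_Mapping.single m a)"
  shows "Q p"
  by (induction p rule: update_induct) (auto simp: update_eq_add_single assms)

text \<open>Additivity reduces multiplicativity of a map to products of two terms.\<close>

lemma comm_ring_hom_if_mult_on_terms:
  fixes f :: "'a::field mpoly \<Rightarrow> 'b::comm_ring_1"
  assumes add: "\<And>p q. f (p + q) = f p + f q"
    and mult: "\<And>m a m' b. f (Poly_Mapping.single m a * Poly_Mapping.single m' b) =
      f (Poly_Mapping.single m a) * f (Poly_Mapping.single m' b)"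
    and one: "f 1 = 1"
  shows "comm_ring_hom f"
proof
  show zero: "f 0 = 0"
    using add[of 0 0] by simp
  have term_mult: "f (Poly_Mapping.single m a * q) = f (Poly_Mapping.single m a) * f q" for m a q
    by (induction q rule: mpoly_induct) (simp_all add: zero add mult distrib_left)
  show "f (p * q) = f p * f q" for p q
    by (induction p rule: mpoly_induct) (simp_all add: zero add term_mult distrib_right)
qed (use add one in auto)

lemma terms_with_single:
  "terms_with P (Poly_Mapping.single m a) = (if P m then Poly_Mapping.single m a else 0)"
  by (rule poly_mapping_eqI) (auto simp: lookup_terms_with lookup_single when_def)

lemma involves_C_zero [simp]: "\<not> involves_C 0"
  by (simp add: involves_C_def)

lemma involves_C_add: "involves_C (m + m') \<longleftrightarrow> involves_C m \<or> involves_C m'"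
  by (auto simp: involves_C_def in_keys_iff lookup_add)

text \<open>
  Discarding all terms that contain some \<open>c\<^sub>\<alpha>\<close> is the same as substituting 0 for the \<open>c\<^sub>\<alpha>\<close>, hence it
  respects products: a product of monomials is free of the \<open>c\<^sub>\<alpha>\<close> if and
  only if both factors are.
\<close>

lemma comm_ring_hom_C_free_part:
  "comm_ring_hom (terms_with (\<lambda>m. \<not> involves_C m) :: 'a::field mpoly \<Rightarrow> 'a mpoly)"
proof (rule comm_ring_hom_if_mult_on_terms)
  show "terms_with (\<lambda>m. \<not> involves_C m) (1 :: 'a mpoly) = 1"
    by (simp add: terms_with_single flip: single_one)
qed (auto simp: mult_single terms_with_single involves_C_add lookup_terms_with lookup_add
    intro: poly_mapping_eqI)

text \<open>
  Substitution of univariate polynomials \<open>\<rho> v\<close> for the variables \<open>v\<close>: the \<open>K\<close>-algebra homomorphism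
  to \<open>K[t]\<close> determined by \<open>\<rho>\<close>. The sum and products range over the finite supports, as in \<open>eval\<close>.
\<close>

definition subst_poly :: "(pvar \<Rightarrow> 'a poly) \<Rightarrow> 'a::field mpoly \<Rightarrow> 'a poly" where
  "subst_poly \<rho> p = (\<Sum>m\<in>Poly_Mapping.keys p. Polynomial.smult (Poly_Mapping.lookup p m)
      (\<Prod>v\<in>Poly_Mapping.keys m. \<rho> v ^ Poly_Mapping.lookup m v))"

lemma subst_poly_single:
  "subst_poly \<rho> (Poly_Mapping.single m a) =
    Polynomial.smult a (\<Prod>v\<in>Poly_Mapping.keys m. \<rho> v ^ Poly_Mapping.lookup m v)"
  by (simp add: subst_poly_def)

lemma subst_poly_Var [simp]: "subst_poly \<rho> (Var v) = \<rho> v"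
  by (simp add: Var_def subst_poly_single)

lemma prod_keys_superset:
  fixes \<rho> :: "pvar \<Rightarrow> 'b::comm_semiring_1"
  assumes "finite S" "Poly_Mapping.keys m \<subseteq> S"
  shows "(\<Prod>v\<in>Poly_Mapping.keys m. \<rho> v ^ Poly_Mapping.lookup m v) = (\<Prod>v\<in>S. \<rho> v ^ Poly_Mapping.lookup m v)"
  using assms by (intro prod.mono_neutral_left) (auto simp: in_keys_iff)

lemma prod_keys_add:
  fixes \<rho> :: "pvar \<Rightarrow> 'b::comm_semiring_1"
  shows "(\<Prod>v\<in>Poly_Mapping.keys (m + m'). \<rho> v ^ Poly_Mapping.lookup (m + m') v) =
    (\<Prod>v\<in>Poly_Mapping.keys m. \<rho> v ^ Poly_Mapping.lookup m v) *
    (\<Prod>v\<in>Poly_Mapping.keys m'. \<rho> v ^ Poly_Mapping.lookup m' v)"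
proof -
  let ?S = "Poly_Mapping.keys m \<union> Poly_Mapping.keys m'"
  have common: "(\<Prod>v\<in>Poly_Mapping.keys k. \<rho> v ^ Poly_Mapping.lookup k v) =
      (\<Prod>v\<in>?S. \<rho> v ^ Poly_Mapping.lookup k v)" if "k \<in> {m, m', m + m'}" for k
    using that keys_add[of m m'] by (intro prod_keys_superset) auto
  show ?thesis
    using common[of m] common[of m'] common[of "m + m'"]
    by (simp add: lookup_add power_add prod.distrib)
qed

lemma comm_ring_hom_subst_poly: "comm_ring_hom (subst_poly \<rho> :: 'a::field mpoly \<Rightarrow> 'a poly)"
proof (rule comm_ring_hom_if_mult_on_terms)
  show "subst_poly \<rho> (p + q) = subst_poly \<rho> p + subst_poly \<rho> q" for p q :: "'a mpoly"
    unfolding subst_poly_def by (rule setsum_keys_plus_distrib) (auto simp: smult_add_left)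
  show "subst_poly \<rho> (1 :: 'a mpoly) = 1"
    by (simp add: subst_poly_single flip: single_one)
qed (simp add: mult_single subst_poly_single prod_keys_add mult.commute)

lemma poly_subst_poly: "poly (subst_poly \<rho> p) a = eval (\<lambda>v. poly (\<rho> v) a) p"
  by (simp add: subst_poly_def eval_def poly_sum poly_prod)

lemma eval_C_free_part:
  assumes "\<And>\<alpha>. \<rho> (C \<alpha>) = 0"
  shows "eval \<rho> (terms_with (\<lambda>m. \<not> involves_C m) p) = eval \<rho> p"
proof -
  have keys: "Poly_Mapping.keys (terms_with (\<lambda>m. \<not> involves_C m) p) =
      {m \<in> Poly_Mapping.keys p. \<not> involves_C m}"
    by (auto simp: in_keys_iff lookup_terms_with split: if_splits)
  have "(\<Prod>v\<in>Poly_Mapping.keys m. \<rho> v ^ Poly_Mapping.lookup m v) = 0" if m: "involves_C m" for m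
  proof -
    obtain \<alpha> where "C \<alpha> \<in> Poly_Mapping.keys m"
      using m by (auto simp: involves_C_def)
    then show ?thesis
      using assms by (intro prod_zero) (auto intro!: bexI[of _ "C \<alpha>"] simp: in_keys_iff)
  qed
  then show ?thesis
    unfolding eval_def keys
    by (intro sum.mono_neutral_cong_left) (auto simp: lookup_terms_with)
qed

section \<open>Uniform determinantal representations\<close>

lemma det_part0_uniform_det_rep:
  fixes M :: "'a::field mpoly mat"
  assumes "uniform_det_rep n d N M"
  shows "det (part0 M) = 0"
proof -
  let ?h = "terms_with (\<lambda>m. \<not> involves_C m) :: 'a mpoly \<Rightarrow> 'a mpoly"
  interpret h: comm_ring_hom ?h
    by (rule comm_ring_hom_C_free_part)
  have "?h (Var (C \<alpha>)) = 0" for \<alpha>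
    by (simp add: Var_def terms_with_single involves_C_def)
  then have "?h (generic_poly n d) = 0"
    by (simp add: generic_poly_def h.hom_sum h.hom_mult)
  with assms show ?thesis
    by (simp add: part0_def uniform_det_rep_def)
qed

lemma subst_poly_generic_poly:
  assumes "\<And>\<alpha>. \<rho> (C \<alpha>) = (if \<alpha> = 0 then q else 0)"
  shows "subst_poly \<rho> (generic_poly n d) = q"
proof -
  interpret h: comm_ring_hom "subst_poly \<rho>"
    by (rule comm_ring_hom_subst_poly)
  \<comment> \<open>The constant monomial has total degree 0, so its coefficient occurs for every \<open>n\<close> and \<open>d\<close>.\<close>
  have "0 \<in> exponents n d"
    by (simp add: exponents_def)
  have "subst_poly \<rho> (generic_poly n d) = (\<Sum>\<alpha>\<in>exponents n d.
      (if \<alpha> = 0 then q else 0) * (\<Prod>i<n. \<rho> (X i) ^ Poly_Mapping.lookup \<alpha> i))"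
    by (simp add: generic_poly_def hom_distribs assms)
  also have "\<dots> = (\<Sum>\<alpha>\<in>exponents n d. if \<alpha> = 0 then q else 0)"
    by (intro sum.cong) auto
  also have "\<dots> = q"
    using \<open>0 \<in> exponents n d\<close> by (simp add: finite_exponents)
  finally show ?thesis .
qed

lemma rank_specialise_part0:
  fixes M :: "'a::field mpoly mat"
  assumes M: "uniform_det_rep n d N M"
  shows "vec_space.rank N (specialise n x (part0 M)) + 1 = N"
proof -
  \<comment> \<open>The indeterminate \<open>[:0, 1:]\<close> replaces \<open>c\<^sub>0\<close>, because the monomial \<open>x\<^sup>0\<close> that it
    multiplies has the value 1 at every point.\<close>
  define \<rho> :: "pvar \<Rightarrow> 'a poly" where
    "\<rho> v = (case v of X i \<Rightarrow> [:if i < n then x $ i else 0:]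
      | C \<alpha> \<Rightarrow> if \<alpha> = 0 then [:0, 1:] else 0)" for v
  interpret h: comm_ring_hom "subst_poly \<rho>"
    by (rule comm_ring_hom_subst_poly)
  define P where "P = map_mat (subst_poly \<rho>) M"
  have "P \<in> carrier_mat N N"
    using M by (simp add: P_def uniform_det_rep_def)
  moreover have "det P = [:0, 1:]"
    using M by (simp add: P_def uniform_det_rep_def subst_poly_generic_poly \<rho>_def)
  ultimately have "vec_space.rank N (map_mat (\<lambda>p. poly p 0) P) + 1 = N"
    by (rule rank_at_simple_zero_of_det)
  moreover have "map_mat (\<lambda>p. poly p 0) P = specialise n x (part0 M)"
  proof -
    let ?\<sigma> = "\<lambda>v. case v of X i \<Rightarrow> if i < n then x $ i else 0 | C \<alpha> \<Rightarrow> 0"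
    have "(\<lambda>v. poly (\<rho> v) 0) = ?\<sigma>"
      by (auto simp: \<rho>_def split: pvar.split)
    then have "poly (subst_poly \<rho> p) 0 = eval ?\<sigma> (terms_with (\<lambda>m. \<not> involves_C m) p)" for p
      by (simp add: poly_subst_poly eval_C_free_part)
    then show ?thesis
      by (intro eq_matI) (simp_all add: P_def specialise_def part0_def)
  qed
  ultimately show ?thesis
    by simp
qed

theorem lemma2p5:
  fixes n d N :: nat and M M0 M1 :: "'a::field mpoly mat"
  assumes "uniform_det_rep n d N M"
    and "M0 = part0 M" and "M1 = part1 M"
  shows "det M0 = 0 \<and>
    (\<forall>x \<in> carrier_vec n. vec_space.rank N (specialise n x M0) + 1 = N)"
  using det_part0_uniform_det_rep[OF assms(1)] rank_specialise_part0[OF assms(1)] assms(2) by simp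

end
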